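(* $\mathsf{EM}$ implies $\mathsf{GP}^2_2$ over $\omega$-models.
   Context: For $f:[\mathbb{N}]^2\to2$ (colorings of pairs $x<y$), a set $H$ is $f$-transitive if it contains no $x<y<z$ with $f(x,y)=f(y,z)=c$ and $f(x,z)=1-c$ for some $c<2$. $\mathsf{EM}$ (Erdős–Moser theorem): "every $f:[\mathbb{N}]^2\to2$ admits an infinite $f$-transitive set." A largeness notion is a collection $\mathbb{L}$ of finite sets closed under supersets such that every infinite set has a finite subset in $\mathbb{L}$ (members are $\mathbb{L}$-large). For $f:[\mathbb{N}]^2\to2$, a sequence $F_0<F_1<\dots$ of $\mathbb{L}$-large sets is an $\mathbb{L}$-grouping for $f$ if for every $i<j$ and all $x_0,x_1\in F_i$, $y_0,y_1\in F_j$, $f(x_0,y_0)=f(x_1,y_1)$. $\mathsf{GP}^2_2$: "for every largeness notion $\mathbb{L}$ and every $f:[\mathbb{N}]^2\to2$ there is an infinite $\mathbb{L}$-grouping for $f$." An $\omega$-model is a second-order arithmetic structure with standard integers whose second-order part is a Turing ideal. *)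

theory Defs
  imports Main "HOL-Library.Nat_Bijection"
begin

text \<open>Relative computability: programs for partial recursive functions that may
  query membership in a set \<open>B\<close>.
  In \<open>Prec g h\<close> the recursion argument comes first, and \<open>h\<close> receives the counter, the previous
  value and the parameters.  The last premise of the rule for \<open>Mn\<close> says that all
  earlier values are defined and nonzero.\<close>

datatype oprog =
    Zero
  | Succ
  | Proj nat
  | Query
  | Comp oprog "oprog list"
  | Prec oprog oprog
  | Mn oprog

inductive computes :: "nat set \<Rightarrow> oprog \<Rightarrow> nat list \<Rightarrow> nat \<Rightarrow> bool" for B :: "nat set" where
  zero: "computes B Zero xs 0"
| succ: "computes B Succ [x] (Suc x)"
| proj: "i < length xs \<Longrightarrow> computes B (Proj i) xs (xs ! i)"
| query: "computes B Query [x] (of_bool (x \<in> B))"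
| comp: "list_all2 (\<lambda>g y. computes B g xs y) gs ys \<Longrightarrow> computes B f ys z
    \<Longrightarrow> computes B (Comp f gs) xs z"
| prec_0: "computes B g xs z \<Longrightarrow> computes B (Prec g h) (0 # xs) z"
| prec_Suc: "computes B (Prec g h) (n # xs) y \<Longrightarrow> computes B h (n # y # xs) z
    \<Longrightarrow> computes B (Prec g h) (Suc n # xs) z"
| mn: "computes B f (n # xs) 0 \<Longrightarrow> \<forall>m<n. \<exists>v. computes B f (m # xs) (Suc v)
    \<Longrightarrow> computes B (Mn f) xs n"

definition turing_reducible :: "nat set \<Rightarrow> nat set \<Rightarrow> bool" (infix "\<le>\<^sub>T" 50) where
  "A \<le>\<^sub>T B \<longleftrightarrow> (\<exists>p. \<forall>x. computes B p [x] (of_bool (x \<in> A)))"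

definition turing_join :: "nat set \<Rightarrow> nat set \<Rightarrow> nat set" where
  "turing_join A B = {2 * n | n. n \<in> A} \<union> {2 * n + 1 | n. n \<in> B}"

definition turing_ideal :: "nat set set \<Rightarrow> bool" where
  "turing_ideal M \<longleftrightarrow> M \<noteq> {}
     \<and> (\<forall>A B. B \<in> M \<longrightarrow> A \<le>\<^sub>T B \<longrightarrow> A \<in> M)
     \<and> (\<forall>A B. A \<in> M \<longrightarrow> B \<in> M \<longrightarrow> turing_join A B \<in> M)"

text \<open>An \<open>\<omega>\<close>-model is identified with its second-order part \<open>M\<close>.  Satisfaction in it is rendered
  by restricting the set quantifiers to \<open>M\<close>; colorings, families of finite sets and sequences of
  finite sets belong to the model when the following codes do.  A coloring \<open>f\<close> of pairs only
  matters at arguments \<open>x < y\<close>, and its two colors are the truth values.\<close>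

definition coloring_in :: "nat set set \<Rightarrow> (nat \<Rightarrow> nat \<Rightarrow> bool) \<Rightarrow> bool" where
  "coloring_in M f \<longleftrightarrow> {prod_encode (x, y) | x y. x < y \<and> f x y} \<in> M"

definition family_in :: "nat set set \<Rightarrow> nat set set \<Rightarrow> bool" where
  "family_in M L \<longleftrightarrow> (\<forall>F\<in>L. finite F) \<and> set_encode ` L \<in> M"

definition sequence_in :: "nat set set \<Rightarrow> (nat \<Rightarrow> nat set) \<Rightarrow> bool" where
  "sequence_in M F \<longleftrightarrow> (\<forall>i. finite (F i)) \<and> {prod_encode (i, set_encode (F i)) | i. True} \<in> M"

definition transitive_for :: "(nat \<Rightarrow> nat \<Rightarrow> bool) \<Rightarrow> nat set \<Rightarrow> bool" where
  "transitive_for f H \<longleftrightarrow>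
     \<not> (\<exists>x\<in>H. \<exists>y\<in>H. \<exists>z\<in>H. \<exists>c. x < y \<and> y < z \<and> f x y = c \<and> f y z = c \<and> f x z = (\<not> c))"

definition EM_in :: "nat set set \<Rightarrow> bool" where
  "EM_in M \<longleftrightarrow> (\<forall>f. coloring_in M f \<longrightarrow> (\<exists>H\<in>M. infinite H \<and> transitive_for f H))"

text \<open>Being a largeness notion is evaluated inside the model: only infinite sets belonging
  to \<open>M\<close> are required to have a large subset.\<close>

definition largeness_notion_in :: "nat set set \<Rightarrow> nat set set \<Rightarrow> bool" where
  "largeness_notion_in M L \<longleftrightarrow> (\<forall>F\<in>L. finite F)
     \<and> (\<forall>F G. F \<in> L \<longrightarrow> F \<subseteq> G \<longrightarrow> finite G \<longrightarrow> G \<in> L)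
     \<and> (\<forall>X\<in>M. infinite X \<longrightarrow> (\<exists>F\<in>L. F \<subseteq> X))"

text \<open>\<open>F < G\<close> stands for \<open>Max F < Min G\<close>, which presupposes that both sets are nonempty.\<close>

definition before :: "nat set \<Rightarrow> nat set \<Rightarrow> bool" where
  "before F G \<longleftrightarrow> F \<noteq> {} \<and> G \<noteq> {} \<and> Max F < Min G"

definition grouping :: "nat set set \<Rightarrow> (nat \<Rightarrow> nat \<Rightarrow> bool) \<Rightarrow> (nat \<Rightarrow> nat set) \<Rightarrow> bool" where
  "grouping L f F \<longleftrightarrow> (\<forall>i. F i \<in> L) \<and> (\<forall>i. before (F i) (F (Suc i)))
     \<and> (\<forall>i j. i < j \<longrightarrow>
          (\<forall>x\<^sub>0\<in>F i. \<forall>x\<^sub>1\<in>F i. \<forall>y\<^sub>0\<in>F j. \<forall>y\<^sub>1\<in>F j. f x\<^sub>0 y\<^sub>0 = f x\<^sub>1 y\<^sub>1))"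

definition GP22_in :: "nat set set \<Rightarrow> bool" where
  "GP22_in M \<longleftrightarrow> (\<forall>L f. family_in M L \<longrightarrow> largeness_notion_in M L \<longrightarrow> coloring_in M f
     \<longrightarrow> (\<exists>F. sequence_in M F \<and> grouping L f F))"

end

theory Submission
  imports Defs "HOL-Library.Infinite_Set"
begin

text \<open>By \<open>EM\<close> we may restrict to an infinite set \<open>H\<close> on which \<open>f\<close> is transitive, that is, on which
  \<open>f\<close> describes a linear order. A greedy search yields large blocks \<open>F\<^sub>0 < F\<^sub>1 < \<dots>\<close> inside \<open>H\<close> such
  that each point of an earlier block sees every later block in one color: finitely many points cut
  \<open>H\<close> into finitely many pieces, one of which is infinite. Now apply \<open>EM\<close> to the coloring of pairs
  \<open>i < j\<close> that tells whether \<open>F\<^sub>j\<close> splits \<open>F\<^sub>i\<close>, that is, whether \<open>f\<close> is not constant on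
  \<open>F\<^sub>i \<times> F\<^sub>j\<close>. If \<open>i < j < k\<close> belong to a transitive set and \<open>F\<^sub>j\<close> does not split \<open>F\<^sub>i\<close>, then
  \<open>F\<^sub>k\<close> does not split \<open>F\<^sub>i\<close> either: by transitivity it would also split \<open>F\<^sub>j\<close>, although the hulls
  of \<open>F\<^sub>i\<close> and \<open>F\<^sub>j\<close> are disjoint. So either infinitely many indices \<open>i\<close> have such a \<open>j\<close>, and they
  can be thinned out to a grouping, or from some point on every block splits all earlier ones; then
  the blocks are nested, their order minima form an infinite homogeneous set, and large subsets of
  that set form a grouping.\<close>

section \<open>Programs\<close>

definition p_add :: oprog where "p_add = Prec (Proj 0) (Comp Succ [Proj 1])"
definition p_pred :: oprog where "p_pred = Prec Zero (Proj 0)"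
text \<open>Truncated subtraction takes the subtrahend first, since \<open>Prec\<close> recurses on
  the first argument.\<close>

definition p_rsub :: oprog where "p_rsub = Prec (Proj 0) (Comp p_pred [Proj 1])"
definition p_triangle :: oprog where
  "p_triangle = Prec Zero (Comp Succ [Comp p_add [Proj 1, Proj 0]])"
definition p_pair :: oprog where
  "p_pair = Comp p_add [Comp p_triangle [Comp p_add [Proj 0, Proj 1]], Proj 0]"
text \<open>Prepares the inversion of \<open>prod_encode (m, n) = triangle (m + n) + m\<close>: the
  sum \<open>m + n\<close> is the least \<open>s\<close> such that the code lies below
  \<open>triangle (Suc s)\<close>, which is when the searched value vanishes.\<close>

definition p_diag :: oprog where
  "p_diag = Mn (Comp p_rsub [Comp p_triangle [Comp Succ [Proj 0]], Comp Succ [Proj 1]])"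
definition p_fst :: oprog where "p_fst = Comp p_rsub [Comp p_triangle [p_diag], Proj 0]"
definition p_snd :: oprog where "p_snd = Comp p_rsub [p_fst, p_diag]"

lemma computes_Comp1:
  "computes B g xs y \<Longrightarrow> computes B f [y] z \<Longrightarrow> computes B (Comp f [g]) xs z"
  by (rule computes.comp[of B xs "[g]" "[y]"]) auto

lemma computes_Comp2:
  "computes B g xs y \<Longrightarrow> computes B g' xs y' \<Longrightarrow> computes B f [y, y'] z
    \<Longrightarrow> computes B (Comp f [g, g']) xs z"
  by (rule computes.comp[of B xs "[g, g']" "[y, y']"]) auto

lemma computes_Proj: "i < length xs \<Longrightarrow> xs ! i = y \<Longrightarrow> computes B (Proj i) xs y"
  using computes.proj by blast

lemma computes_p_add: "computes B p_add [x, y] (x + y)"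
proof (induction x)
  case 0
  show ?case unfolding p_add_def by (auto intro!: computes.prec_0 computes_Proj)
next
  case (Suc x)
  then show ?case unfolding p_add_def
    by (auto intro!: computes.prec_Suc computes_Comp1 computes_Proj computes.succ)
qed

lemma computes_p_pred: "computes B p_pred [x] (x - 1)"
proof (induction x)
  case 0
  show ?case unfolding p_pred_def by (auto intro!: computes.prec_0 computes.zero)
next
  case (Suc x)
  then show ?case unfolding p_pred_def by (auto intro!: computes.prec_Suc computes_Proj)
qed

lemma computes_p_rsub: "computes B p_rsub [x, y] (y - x)"
proof (induction x)
  case 0
  show ?case unfolding p_rsub_def by (auto intro!: computes.prec_0 computes_Proj)
next
  case (Suc x)
  have "computes B p_pred [y - x] (y - Suc x)" using computes_p_pred[of B "y - x"] by simp
  then show ?case using Suc unfolding p_rsub_def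
    by (auto intro!: computes.prec_Suc computes_Comp1 computes_Proj)
qed

lemma computes_p_triangle: "computes B p_triangle [n] (triangle n)"
proof (induction n)
  case 0
  show ?case unfolding p_triangle_def by (auto intro!: computes.prec_0 computes.zero)
next
  case (Suc n)
  have "computes B (Comp Succ [Comp p_add [Proj 1, Proj 0]]) [n, triangle n] (Suc (triangle n + n))"
    by (rule computes_Comp1[OF computes_Comp2 computes.succ])
       (auto intro!: computes_Proj computes_p_add)
  then show ?case using Suc unfolding p_triangle_def by (auto intro!: computes.prec_Suc)
qed

lemma computes_p_pair: "computes B p_pair [m, n] (prod_encode (m, n))"
  unfolding p_pair_def prod_encode_def
  by (auto intro!: computes_Comp2 computes_Comp1 computes_Proj computes_p_add computes_p_triangle)

lemma triangle_mono: "m \<le> n \<Longrightarrow> triangle m \<le> triangle n"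
  by (induction rule: dec_induct) auto

lemma computes_p_diag: "computes B p_diag [prod_encode (m, n)] (m + n)"
proof -
  let ?z = "prod_encode (m, n)"
  let ?f = "Comp p_rsub [Comp p_triangle [Comp Succ [Proj 0]], Comp Succ [Proj 1]]"
  have *: "computes B ?f [s, ?z] (Suc ?z - triangle (Suc s))" for s
    by (rule computes_Comp2[OF computes_Comp1[OF computes_Comp1] computes_Comp1],
        rule computes_Proj[OF _ refl], simp, simp, rule computes.succ, rule computes_p_triangle,
        rule computes_Proj[OF _ refl], simp, rule computes.succ)
       (simp only: nth_Cons_0 nth_Cons_Suc One_nat_def computes_p_rsub)
  have "Suc ?z - triangle (Suc (m + n)) = 0" by (simp add: prod_encode_def)
  then have "computes B ?f [m + n, ?z] 0" using *[of "m + n"] by simp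
  moreover have "\<exists>v. computes B ?f [s, ?z] (Suc v)" if "s < m + n" for s
  proof -
    have "triangle (Suc s) \<le> triangle (m + n)" using that by (intro triangle_mono) simp
    then have "Suc ?z - triangle (Suc s) = Suc (?z - triangle (Suc s))"
      by (simp add: prod_encode_def)
    then show ?thesis using *[of s] by metis
  qed
  ultimately show ?thesis unfolding p_diag_def by (auto intro!: computes.mn)
qed

lemma computes_p_fst: "computes B p_fst [z] (fst (prod_decode z))"
proof -
  obtain m n where z: "z = prod_encode (m, n)" by (metis prod_decode_inverse surj_pair)
  have "computes B p_fst [z] (z - triangle (m + n))" unfolding p_fst_def
    unfolding z by (rule computes_Comp2[OF computes_Comp1[OF computes_p_diag computes_p_triangle]
        computes_Proj computes_p_rsub]) simp_all
  then show ?thesis by (simp add: z) (simp add: prod_encode_def)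
qed

lemma computes_p_snd: "computes B p_snd [z] (snd (prod_decode z))"
proof -
  obtain m n where z: "z = prod_encode (m, n)" by (metis prod_decode_inverse surj_pair)
  have "computes B p_snd [z] ((m + n) - fst (prod_decode z))" unfolding p_snd_def
    unfolding z by (rule computes_Comp2[OF computes_p_fst computes_p_diag computes_p_rsub])
  then show ?thesis by (simp add: z)
qed

section \<open>Change of oracle\<close>

primrec query_subst :: "oprog \<Rightarrow> oprog \<Rightarrow> oprog" where
  "query_subst q Zero = Zero"
| "query_subst q Succ = Succ"
| "query_subst q (Proj i) = Proj i"
| "query_subst q Query = q"
| "query_subst q (Comp f gs) = Comp (query_subst q f) (map (query_subst q) gs)"
| "query_subst q (Prec g h) = Prec (query_subst q g) (query_subst q h)"
| "query_subst q (Mn f) = Mn (query_subst q f)"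

text \<open>Since \<open>q\<close> answers queries to \<open>A\<close> from \<open>B\<close>, a
  computation relative to \<open>A\<close> can be replayed relative to \<open>B\<close> rule by
  rule.\<close>

lemma computes_query_subst:
  assumes "\<And>x. computes B q [x] (of_bool (x \<in> A))" and "computes A p xs y"
  shows "computes B (query_subst q p) xs y"
  using assms(2)
proof (induction rule: computes.induct)
  case (comp xs gs ys f z)
  have "list_all2 (\<lambda>g y. computes B g xs y) (map (query_subst q) gs) ys"
    using comp(1) by (auto simp: list_all2_conv_all_nth)
  then show ?case using comp by (auto intro: computes.comp)
next
  case (mn f n xs)
  then show ?case by (auto intro!: computes.mn)
next
  case (query x)
  then show ?case using assms(1) by (simp only: query_subst.simps)
qed (auto intro: computes.intros)

lemma turing_reducible_join: "A \<le>\<^sub>T turing_join A B" "B \<le>\<^sub>T turing_join A B"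
proof -
  let ?J = "turing_join A B"
  have d: "computes ?J (Comp p_add [Proj 0, Proj 0]) [x] (2 * x)" for x
    by (rule computes_Comp2) (auto intro!: computes_Proj simp: mult_2 computes_p_add)
  have a: "2 * x \<in> ?J \<longleftrightarrow> x \<in> A" for x unfolding turing_join_def by auto presburger
  have b: "Suc (2 * x) \<in> ?J \<longleftrightarrow> x \<in> B" for x unfolding turing_join_def by auto presburger
  have "computes ?J (Comp Query [Comp p_add [Proj 0, Proj 0]]) [x] (of_bool (x \<in> A))" for x
    using computes_Comp1[OF d computes.query] unfolding a .
  then show "A \<le>\<^sub>T ?J" unfolding turing_reducible_def by blast
  have "computes ?J (Comp Query [Comp Succ [Comp p_add [Proj 0, Proj 0]]]) [x] (of_bool (x \<in> B))" for x
    using computes_Comp1[OF computes_Comp1[OF d computes.succ] computes.query] unfolding b .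
  then show "B \<le>\<^sub>T ?J" unfolding turing_reducible_def by blast
qed


section \<open>Functions and relations computable in a Turing ideal\<close>

abbreviation pr1 :: "nat \<Rightarrow> nat" where "pr1 z \<equiv> fst (prod_decode z)"
abbreviation pr2 :: "nat \<Rightarrow> nat" where "pr2 z \<equiv> snd (prod_decode z)"

locale omega_model =
  fixes M :: "nat set set"
  assumes ideal: "turing_ideal M"
begin

text \<open>A function belongs to the model when a member of \<open>M\<close> computes it. Closure
  rules for such functions spare the combinatorial part all handling of programs.\<close>

definition mfun :: "(nat \<Rightarrow> nat) \<Rightarrow> bool" where
  "mfun \<phi> \<longleftrightarrow> (\<exists>B\<in>M. \<exists>p. \<forall>x. computes B p [x] (\<phi> x))"

abbreviation mpred :: "(nat \<Rightarrow> bool) \<Rightarrow> bool" where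
  "mpred P \<equiv> mfun (\<lambda>x. of_bool (P x))"

abbreviation mrel :: "(nat \<Rightarrow> nat \<Rightarrow> bool) \<Rightarrow> bool" where
  "mrel R \<equiv> mpred (\<lambda>z. R (pr1 z) (pr2 z))"

text \<open>Programs can be combined only over one oracle. The join lies in \<open>M\<close>, and
  \<open>query_subst\<close> translates programs for either half.\<close>

lemma common_oracle:
  assumes "A \<in> M" "B \<in> M"
  obtains C \<rho> \<sigma> where "C \<in> M"
    "\<And>p xs y. computes A p xs y \<Longrightarrow> computes C (\<rho> p) xs y"
    "\<And>p xs y. computes B p xs y \<Longrightarrow> computes C (\<sigma> p) xs y"
proof -
  have "turing_join A B \<in> M" using ideal assms unfolding turing_ideal_def by blast
  moreover obtain q where "\<And>x. computes (turing_join A B) q [x] (of_bool (x \<in> A))"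
    using turing_reducible_join(1) unfolding turing_reducible_def by blast
  moreover obtain q' where "\<And>x. computes (turing_join A B) q' [x] (of_bool (x \<in> B))"
    using turing_reducible_join(2) unfolding turing_reducible_def by blast
  ultimately show ?thesis
    using that[of "turing_join A B" "query_subst q" "query_subst q'"] computes_query_subst by blast
qed

lemma mfun_common2:
  assumes "mfun \<phi>" "mfun \<psi>"
  obtains B p q where "B \<in> M" "\<And>x. computes B p [x] (\<phi> x)" "\<And>x. computes B q [x] (\<psi> x)"
proof -
  obtain A p where A: "A \<in> M" "\<And>x. computes A p [x] (\<phi> x)"
    using assms(1) unfolding mfun_def by blast
  obtain B q where B: "B \<in> M" "\<And>x. computes B q [x] (\<psi> x)"
    using assms(2) unfolding mfun_def by blast
  show ?thesis using common_oracle[OF A(1) B(1)] that A B by metis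
qed

lemma mfunI: "B \<in> M \<Longrightarrow> (\<And>x. computes B p [x] (\<phi> x)) \<Longrightarrow> mfun \<phi>"
  unfolding mfun_def by blast

lemma mem_iff_mpred: "A \<in> M \<longleftrightarrow> mpred (\<lambda>x. x \<in> A)"
proof
  assume "A \<in> M" then show "mpred (\<lambda>x. x \<in> A)" by (rule mfunI) (rule computes.query)
next
  assume "mpred (\<lambda>x. x \<in> A)"
  then show "A \<in> M" using ideal unfolding mfun_def turing_ideal_def turing_reducible_def by blast
qed

lemma mfun_comp:
  assumes "mfun \<phi>" "mfun \<psi>" shows "mfun (\<lambda>x. \<phi> (\<psi> x))"
proof -
  obtain B p q where "B \<in> M" "\<And>x. computes B p [x] (\<phi> x)" "\<And>x. computes B q [x] (\<psi> x)"
    using mfun_common2[OF assms] by blast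
  then show ?thesis by (intro mfunI[OF _ computes_Comp1])
qed

lemma mfun_op2:
  assumes "\<And>B x y. computes B p [x, y] (f x y)" "mfun \<phi>" "mfun \<psi>"
  shows "mfun (\<lambda>x. f (\<phi> x) (\<psi> x))"
proof -
  obtain B q r where "B \<in> M" "\<And>x. computes B q [x] (\<phi> x)" "\<And>x. computes B r [x] (\<psi> x)"
    using mfun_common2[OF assms(2,3)] by blast
  then show ?thesis by (intro mfunI[OF _ computes_Comp2[OF _ _ assms(1)]])
qed

lemma ex_oracle: "\<exists>B. B \<in> M"
  using ideal unfolding turing_ideal_def by blast

lemma mfun_id: "mfun (\<lambda>x. x)"
proof -
  obtain B where "B \<in> M" using ex_oracle ..
  then show ?thesis by (rule mfunI) (rule computes_Proj[of 0], simp_all)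
qed

lemma mfun_Suc:
  assumes "mfun \<phi>" shows "mfun (\<lambda>x. Suc (\<phi> x))"
proof -
  obtain B where "B \<in> M" using ex_oracle ..
  then have "mfun Suc" by (rule mfunI) (rule computes.succ)
  then show ?thesis using assms by (rule mfun_comp)
qed

lemma mfun_const: "mfun (\<lambda>x. c)"
proof (induction c)
  case 0
  obtain B where "B \<in> M" using ex_oracle ..
  then show ?case by (rule mfunI) (rule computes.zero)
qed (rule mfun_Suc)

lemma mfun_add: "mfun \<phi> \<Longrightarrow> mfun \<psi> \<Longrightarrow> mfun (\<lambda>x. \<phi> x + \<psi> x)"
  using mfun_op2[OF computes_p_add] .

lemma mfun_diff: "mfun \<phi> \<Longrightarrow> mfun \<psi> \<Longrightarrow> mfun (\<lambda>x. \<phi> x - \<psi> x)"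
  using mfun_op2[OF computes_p_rsub] .

lemma mfun_pair: "mfun \<phi> \<Longrightarrow> mfun \<psi> \<Longrightarrow> mfun (\<lambda>x. prod_encode (\<phi> x, \<psi> x))"
  using mfun_op2[OF computes_p_pair] .

lemma mfun_pr1:
  assumes "mfun \<phi>" shows "mfun (\<lambda>x. pr1 (\<phi> x))"
proof -
  obtain B where "B \<in> M" using ex_oracle ..
  then have "mfun pr1" by (rule mfunI) (rule computes_p_fst)
  then show ?thesis using assms by (rule mfun_comp)
qed

lemma mfun_pr2:
  assumes "mfun \<phi>" shows "mfun (\<lambda>x. pr2 (\<phi> x))"
proof -
  obtain B where "B \<in> M" using ex_oracle ..
  then have "mfun pr2" by (rule mfunI) (rule computes_p_snd)
  then show ?thesis using assms by (rule mfun_comp)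
qed

lemma mfun_rec:
  assumes "mfun \<phi>" "mfun (\<lambda>z. h (pr1 z) (pr1 (pr2 z)) (pr2 (pr2 z)))" "mfun b"
  shows "mfun (\<lambda>x. rec_nat (\<phi> x) (\<lambda>n r. h x n r) (b x))"
proof -
  let ?h = "\<lambda>z. h (pr1 z) (pr1 (pr2 z)) (pr2 (pr2 z))"
  obtain B p q where B: "B \<in> M" "\<And>x. computes B p [x] (\<phi> x)" "\<And>x. computes B q [x] (?h x)"
    using mfun_common2[OF assms(1,2)] by metis
  \<comment> \<open>\<open>Prec\<close> supplies counter, previous value and parameter; the unary
    program for \<open>h\<close> expects them in one code with the parameter first.\<close>
  let ?q = "Comp q [Comp p_pair [Proj 2, Comp p_pair [Proj 0, Proj 1]]]"
  have q: "computes B ?q [n, r, x] (h x n r)" for n r x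
  proof -
    have "computes B (Comp p_pair [Proj 2, Comp p_pair [Proj 0, Proj 1]]) [n, r, x]
        (prod_encode (x, prod_encode (n, r)))"
      by (auto intro!: computes_Comp2[OF _ computes_Comp2] computes_Proj computes_p_pair)
    from computes_Comp1[OF this B(3)] show ?thesis by simp
  qed
  have rec: "computes B (Prec p ?q) [n, x] (rec_nat (\<phi> x) (\<lambda>n r. h x n r) n)" for n x
  proof (induction n)
    case 0
    show ?case using B(2) by (auto intro!: computes.prec_0)
  next
    case (Suc n)
    then show ?case using computes.prec_Suc[OF Suc] q by simp
  qed
  have "mfun (\<lambda>z. rec_nat (\<phi> (pr2 z)) (\<lambda>n r. h (pr2 z) n r) (pr1 z))"
    by (rule mfunI[OF B(1)], rule computes_Comp2[OF computes_p_fst computes_p_snd], rule rec)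
  from mfun_comp[OF this mfun_pair[OF assms(3) mfun_id]] show ?thesis by simp
qed

text \<open>This is a recursion whose length is the truth value: no step leaves
  \<open>\<psi> x\<close>, one step replaces it by \<open>\<phi> x\<close>.\<close>

lemma mfun_if:
  assumes "mpred P" "mfun \<phi>" "mfun \<psi>"
  shows "mfun (\<lambda>x. if P x then \<phi> x else \<psi> x)"
proof -
  have "(\<lambda>x. if P x then \<phi> x else \<psi> x) = (\<lambda>x. rec_nat (\<psi> x) (\<lambda>_ _. \<phi> x) (of_bool (P x)))"
    by (auto simp: fun_eq_iff)
  then show ?thesis
    using mfun_rec[of \<psi> "\<lambda>x _ _. \<phi> x"] assms mfun_comp[OF assms(2) mfun_pr1[OF mfun_id]] by simp
qed

text \<open>\<open>Mn\<close> looks for a zero, so the searched program computes the negation of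
  \<open>P\<close>; the second assumption makes the search stop everywhere.\<close>

lemma mfun_Least:
  assumes "mpred (\<lambda>z. P (pr1 z) (pr2 z))" "\<And>x. \<exists>n. P x n"
  shows "mfun (\<lambda>x. LEAST n. P x n)"
proof -
  have "mfun (\<lambda>z. 1 - of_bool (P (pr1 z) (pr2 z)))" by (intro mfun_diff mfun_const assms)
  then obtain B p where B: "B \<in> M" "\<And>z. computes B p [z] (1 - of_bool (P (pr1 z) (pr2 z)))"
    unfolding mfun_def by blast
  let ?p = "Comp p [Comp p_pair [Proj 1, Proj 0]]"
  have p: "computes B ?p [n, x] (1 - of_bool (P x n))" for n x
  proof -
    have "computes B (Comp p_pair [Proj 1, Proj 0]) [n, x] (prod_encode (x, n))"
      by (auto intro!: computes_Comp2 computes_Proj computes_p_pair)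
    from computes_Comp1[OF this B(2)] show ?thesis by simp
  qed
  have "computes B (Mn ?p) [x] (LEAST n. P x n)" for x
  proof (rule computes.mn)
    show "computes B ?p [LEAST n. P x n, x] 0"
      using p[of "LEAST n. P x n" x] LeastI_ex[OF assms(2)[of x]] by simp
    have "computes B ?p [m, x] (Suc 0)" if "m < (LEAST n. P x n)" for m
      using p[of m x] not_less_Least[OF that] by simp
    then show "\<forall>m<LEAST n. P x n. \<exists>v. computes B ?p [m, x] (Suc v)" by blast
  qed
  then show ?thesis by (rule mfunI[OF B(1)])
qed

section \<open>Decidable predicates, arithmetic and coded finite sets\<close>

lemma mpred_mem: "A \<in> M \<Longrightarrow> mfun \<phi> \<Longrightarrow> mpred (\<lambda>x. \<phi> x \<in> A)"
  unfolding mem_iff_mpred by (rule mfun_comp)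

lemma mpred_rel: "mrel R \<Longrightarrow> mfun \<phi> \<Longrightarrow> mfun \<psi> \<Longrightarrow> mpred (\<lambda>x. R (\<phi> x) (\<psi> x))"
  using mfun_comp[OF _ mfun_pair, of "\<lambda>z. of_bool (R (pr1 z) (pr2 z))" \<phi> \<psi>] by simp

lemma mpred_not: "mpred P \<Longrightarrow> mpred (\<lambda>x. \<not> P x)"
proof -
  assume "mpred P"
  then have "mfun (\<lambda>x. 1 - of_bool (P x))" by (intro mfun_diff mfun_const)
  moreover have "(\<lambda>x. 1 - of_bool (P x) :: nat) = (\<lambda>x. of_bool (\<not> P x))" by auto
  ultimately show ?thesis by simp
qed

lemma mpred_conj: "mpred P \<Longrightarrow> mpred Q \<Longrightarrow> mpred (\<lambda>x. P x \<and> Q x)"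
proof -
  assume "mpred P" "mpred Q"
  then have "mfun (\<lambda>x. of_bool (P x) + of_bool (Q x) - 1)" by (intro mfun_diff mfun_add mfun_const)
  moreover have "(\<lambda>x. of_bool (P x) + of_bool (Q x) - 1 :: nat) = (\<lambda>x. of_bool (P x \<and> Q x))"
    by (auto simp: fun_eq_iff)
  ultimately show ?thesis by simp
qed

lemma mpred_imp: "mpred P \<Longrightarrow> mpred Q \<Longrightarrow> mpred (\<lambda>x. P x \<longrightarrow> Q x)"
  unfolding imp_conv_disj[of "P _"] de_Morgan_conj[of "P _" "\<not> Q _", unfolded not_not, symmetric]
  by (intro mpred_not mpred_conj)

lemma mpred_less: "mfun \<phi> \<Longrightarrow> mfun \<psi> \<Longrightarrow> mpred (\<lambda>x. \<phi> x < \<psi> x)"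
proof -
  assume "mfun \<phi>" "mfun \<psi>"
  then have "mfun (\<lambda>x. 1 - (1 - (\<psi> x - \<phi> x)))" by (intro mfun_diff mfun_const)
  moreover have "(\<lambda>x. 1 - (1 - (\<psi> x - \<phi> x))) = (\<lambda>x. of_bool (\<phi> x < \<psi> x))"
    by (auto simp: fun_eq_iff)
  ultimately show ?thesis by simp
qed

lemma mpred_le: "mfun \<phi> \<Longrightarrow> mfun \<psi> \<Longrightarrow> mpred (\<lambda>x. \<phi> x \<le> \<psi> x)"
  unfolding not_less[symmetric] by (intro mpred_not mpred_less)

lemma mpred_eq: "mfun \<phi> \<Longrightarrow> mfun \<psi> \<Longrightarrow> mpred (\<lambda>x. \<phi> x = \<psi> x)"
  unfolding eq_iff[of "_ :: nat"] by (intro mpred_conj mpred_le)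

lemma mpred_iff: "mpred P \<Longrightarrow> mpred Q \<Longrightarrow> mpred (\<lambda>x. P x \<longleftrightarrow> Q x)"
  unfolding iff_conv_conj_imp by (intro mpred_conj mpred_imp)

lemma mpred_all_less:
  assumes "mpred (\<lambda>z. P (pr1 z) (pr2 z))" "mfun b"
  shows "mpred (\<lambda>x. \<forall>n<b x. P x n)"
proof -
  have "rec_nat 1 (\<lambda>n r. if P x n then r else 0) k = (of_bool (\<forall>n<k. P x n) :: nat)" for x k
    by (induction k) (auto simp: less_Suc_eq)
  moreover have "mfun (\<lambda>x. rec_nat 1 (\<lambda>n r. if P x n then r else 0) (b x))"
    by (rule mfun_rec[OF mfun_const _ assms(2)])
       (intro mfun_if mpred_rel[OF assms(1)] mfun_pr1 mfun_pr2 mfun_id mfun_const)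
  ultimately show ?thesis by simp
qed

lemma mfun_half: "mfun \<phi> \<Longrightarrow> mfun (\<lambda>x. \<phi> x div 2)"
proof (rule mfun_comp[of "\<lambda>n. n div 2"])
  \<comment> \<open>Halving follows the recurrence \<open>Suc n div 2 = n - n div 2\<close>.\<close>
  have "rec_nat 0 (\<lambda>n r. n - r) n = n div 2" for n
  proof (induction n)
    case (Suc n)
    have "n - n div 2 = Suc n div 2" by presburger
    with Suc show ?case by simp
  qed simp
  moreover have "mfun (\<lambda>x. rec_nat 0 (\<lambda>n r. n - r) x)"
    by (rule mfun_rec) (intro mfun_diff mfun_pr1 mfun_pr2 mfun_id mfun_const)+
  ultimately show "mfun (\<lambda>n. n div 2)" by simp
qed

lemma mpred_odd: "mfun \<phi> \<Longrightarrow> mpred (\<lambda>x. odd (\<phi> x))"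
proof (rule mfun_comp[of "\<lambda>n. of_bool (odd n)"])
  have "rec_nat 0 (\<lambda>n r. 1 - r) n = (of_bool (odd n) :: nat)" for n
    by (induction n) auto
  moreover have "mfun (\<lambda>x. rec_nat 0 (\<lambda>n r. 1 - r) x)"
    by (rule mfun_rec) (intro mfun_diff mfun_pr1 mfun_pr2 mfun_id mfun_const)+
  ultimately show "mpred odd" by simp
qed

lemma mfun_pow2: "mfun \<phi> \<Longrightarrow> mfun (\<lambda>x. 2 ^ \<phi> x)"
proof (rule mfun_comp[of "\<lambda>n. 2 ^ n"])
  have "rec_nat 1 (\<lambda>n r. r + r) n = (2 ^ n :: nat)" for n
    by (induction n) auto
  moreover have "mfun (\<lambda>x. rec_nat 1 (\<lambda>n r. r + r) x)"
    by (rule mfun_rec) (intro mfun_add mfun_pr1 mfun_pr2 mfun_id mfun_const)+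
  ultimately show "mfun (\<lambda>n. 2 ^ n)" by simp
qed

lemma mpred_set_decode: "mfun \<phi> \<Longrightarrow> mfun \<psi> \<Longrightarrow> mpred (\<lambda>x. \<phi> x \<in> set_decode (\<psi> x))"
proof -
  assume a: "mfun \<phi>" "mfun \<psi>"
  \<comment> \<open>Membership of \<open>x\<close> is the parity of the code after \<open>x\<close>
    halvings.\<close>
  have shift: "rec_nat c (\<lambda>_ r. r div 2) n = c div 2 ^ n" for c n :: nat
    by (induction n) (simp_all add: div_mult2_eq[symmetric] mult.commute)
  have "mpred (\<lambda>x. odd (rec_nat (\<psi> x) (\<lambda>_ r. r div 2) (\<phi> x)))"
    by (intro mpred_odd mfun_rec[OF a(2) _ a(1)] mfun_half mfun_pr2 mfun_id)
  then show ?thesis by (simp add: shift set_decode_def)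
qed

text \<open>The chain \<open>x < 2 ^ x \<le> c\<close> turns quantifiers over a coded set into
  bounded ones.\<close>

lemma set_decode_less: "x \<in> set_decode c \<Longrightarrow> x < c"
proof -
  assume "x \<in> set_decode c"
  then have "c div 2 ^ x \<noteq> 0" unfolding set_decode_def by (auto intro: ccontr)
  then have "2 ^ x \<le> c" by (simp add: div_eq_0_iff)
  then show "x < c" using less_exp[of x] by (rule order.strict_trans2[rotated])
qed

lemma mpred_all_set_decode:
  assumes "mpred (\<lambda>z. P (pr1 z) (pr2 z))" "mfun \<phi>"
  shows "mpred (\<lambda>x. \<forall>n\<in>set_decode (\<phi> x). P x n)"
proof -
  have "(\<forall>n\<in>set_decode (\<phi> x). P x n) \<longleftrightarrow> (\<forall>n<\<phi> x. n \<in> set_decode (\<phi> x) \<longrightarrow> P x n)" for x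
    using set_decode_less by blast
  moreover have "mpred (\<lambda>x. \<forall>n<\<phi> x. n \<in> set_decode (\<phi> x) \<longrightarrow> P x n)"
    by (intro mpred_all_less mpred_imp mpred_set_decode assms mfun_pr2 mfun_id
        mfun_comp[OF assms(2) mfun_pr1])
  ultimately show ?thesis by simp
qed

lemmas mintros = mfun_id mfun_const mfun_pair mfun_pr1 mfun_pr2 mpred_mem mpred_not mpred_conj
  mpred_imp mpred_less mpred_le mpred_eq mpred_iff mpred_set_decode mpred_all_set_decode

lemma Collect_mem: "mpred P \<Longrightarrow> {x. P x} \<in> M"
  by (simp add: mem_iff_mpred)

lemma mfun_enumerate:
  assumes "T \<in> M" "infinite T"
  shows "mfun (enumerate T)"
proof -
  have "\<exists>k. k \<in> T \<and> r < k" for r using assms(2) infinite_nat_iff_unbounded by blast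
  then have "mfun (\<lambda>r. LEAST k. k \<in> T \<and> r < k)"
    by (intro mfun_Least mpred_conj mpred_mem mpred_less mfun_pr1 mfun_pr2 mfun_id assms(1))
  then have "mfun (\<lambda>x. rec_nat (LEAST k. k \<in> T) (\<lambda>n r. LEAST k. k \<in> T \<and> r < k) x)"
    by (rule mfun_rec[OF mfun_const mfun_comp mfun_id]) (intro mfun_pr2 mfun_id)
  moreover have "rec_nat (LEAST k. k \<in> T) (\<lambda>n r. LEAST k. k \<in> T \<and> r < k) x = enumerate T x" for x
    by (induction x) (auto simp: enumerate_0 enumerate_Suc''[OF assms(2)] simp del: enumerate_Suc)
  ultimately show ?thesis by simp
qed

end


section \<open>Greedy sets\<close>

text \<open>The decision about \<open>k\<close> depends only on the finitely many earlier decisions,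
  which is what makes the greedy set computable from \<open>T\<close> and \<open>R\<close>.\<close>

primrec greedy_upto :: "nat set \<Rightarrow> (nat \<Rightarrow> nat \<Rightarrow> bool) \<Rightarrow> nat \<Rightarrow> nat set" where
  "greedy_upto T R 0 = {}"
| "greedy_upto T R (Suc k) =
     (if k \<in> T \<and> (\<forall>n\<in>greedy_upto T R k. R n k) then insert k (greedy_upto T R k)
      else greedy_upto T R k)"

definition greedy_set :: "nat set \<Rightarrow> (nat \<Rightarrow> nat \<Rightarrow> bool) \<Rightarrow> nat set" where
  "greedy_set T R = {k. k \<in> T \<and> (\<forall>n\<in>greedy_upto T R k. R n k)}"

lemma greedy_upto_eq: "greedy_upto T R k = {n \<in> greedy_set T R. n < k}"
proof (induction k)
  case (Suc k)
  have "k \<in> greedy_set T R \<longleftrightarrow> k \<in> T \<and> (\<forall>n\<in>greedy_upto T R k. R n k)" by (simp add: greedy_set_def)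
  with Suc show ?case by (auto simp: less_Suc_eq)
qed simp

lemma in_greedy_set_iff:
  "k \<in> greedy_set T R \<longleftrightarrow> k \<in> T \<and> (\<forall>n\<in>greedy_set T R. n < k \<longrightarrow> R n k)"
  by (subst greedy_set_def) (auto simp: greedy_upto_eq)

text \<open>Applied to a finite greedy set, the assumption yields a \<open>k\<close> beyond it that
  the greedy rule would have accepted.\<close>

lemma infinite_greedy_set:
  assumes "\<And>S. finite S \<Longrightarrow> S \<subseteq> T \<Longrightarrow> \<exists>k\<in>T. \<forall>n\<in>S. n < k \<and> R n k"
  shows "infinite (greedy_set T R)"
proof
  assume "finite (greedy_set T R)"
  moreover have "greedy_set T R \<subseteq> T" using in_greedy_set_iff by blast
  ultimately obtain k where "k \<in> T" "\<forall>n\<in>greedy_set T R. n < k \<and> R n k" using assms by blast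
  moreover from this have "k \<in> greedy_set T R" using in_greedy_set_iff by blast
  ultimately show False by blast
qed

context omega_model
begin

lemma greedy_set_mem:
  assumes "T \<in> M" "mrel R"
  shows "greedy_set T R \<in> M"
proof -
  define step where
    "step k s = (if k \<in> T \<and> (\<forall>n\<in>set_decode s. R n k) then s + 2 ^ k else s)" for k s
  have code: "rec_nat 0 step k = set_encode (greedy_upto T R k)" for k
  proof (induction k)
    case (Suc k)
    have "finite (greedy_upto T R k)" "k \<notin> greedy_upto T R k" by (simp_all add: greedy_upto_eq)
    with Suc show ?case by (simp add: step_def set_encode_insert)
  qed simp
  have "mfun (\<lambda>k. rec_nat 0 (\<lambda>n r. step n r) k)" unfolding step_def
    by (rule mfun_rec[OF mfun_const _ mfun_id])
       (intro mfun_if mfun_add mfun_pow2 mpred_rel[OF assms(2)] assms(1) mintros)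
  then have "mpred (\<lambda>k. k \<in> T \<and> (\<forall>n\<in>set_decode (set_encode (greedy_upto T R k)). R n k))"
    unfolding code[symmetric]
    by (intro mintros mpred_rel[OF assms(2)] assms(1))
       (rule mfun_comp[of "rec_nat 0 step"], assumption, intro mintros)
  moreover have "finite (greedy_upto T R k)" for k by (simp add: greedy_upto_eq)
  ultimately show ?thesis by (simp add: mem_iff_mpred greedy_set_def)
qed

text \<open>The basic way to thin out a set inside \<open>M\<close>. The extension property is
  purely existential: no choice of \<open>k\<close> has to be computed.\<close>

lemma greedy:
  assumes "T \<in> M" "mrel R"
    and "\<And>S. finite S \<Longrightarrow> S \<subseteq> T \<Longrightarrow> \<exists>k\<in>T. \<forall>n\<in>S. n < k \<and> R n k"
  obtains G where "G \<in> M" "infinite G" "G \<subseteq> T" "\<And>n k. n \<in> G \<Longrightarrow> k \<in> G \<Longrightarrow> n < k \<Longrightarrow> R n k"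
proof (rule that)
  show "greedy_set T R \<in> M" by (rule greedy_set_mem[OF assms(1,2)])
  show "infinite (greedy_set T R)" by (rule infinite_greedy_set[OF assms(3)])
  show "greedy_set T R \<subseteq> T" using in_greedy_set_iff by blast
  show "R n k" if "n \<in> greedy_set T R" "k \<in> greedy_set T R" "n < k" for n k
    using that in_greedy_set_iff by blast
qed

text \<open>The image of \<open>X\<close> is merely enumerable in the model and may fall outside
  \<open>M\<close>; on a part of \<open>X\<close> where \<open>\<phi>\<close> is strictly increasing
  the image becomes decidable.\<close>

lemma infinite_image_subset:
  assumes "X \<in> M" "mfun \<phi>" "infinite (\<phi> ` X)"
  obtains Y where "Y \<in> M" "infinite Y" "Y \<subseteq> \<phi> ` X"
proof -
  have ext: "\<exists>k\<in>X. \<forall>n\<in>S. n < k \<and> \<phi> n < \<phi> k" if "finite S" for S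
  proof -
    define N where "N = Max (insert 0 (S \<union> \<phi> ` S))"
    \<comment> \<open>A value not taken on \<open>{..N}\<close> is only taken at arguments beyond
      \<open>N\<close>, so argument and value both exceed everything in \<open>S\<close> and its
      image.\<close>
    have "infinite (\<phi> ` X - \<phi> ` {..N} - {..N})" using assms(3) by simp
    then obtain y where "y \<in> \<phi> ` X - \<phi> ` {..N} - {..N}" by (metis finite.emptyI all_not_in_conv)
    then obtain k where k: "k \<in> X" "\<phi> k \<notin> \<phi> ` {..N}" "N < \<phi> k" by (auto simp: not_le)
    then have "N < k" by (meson atMost_iff imageI not_le)
    moreover have "n \<le> N" "\<phi> n \<le> N" if "n \<in> S" for n
      using \<open>finite S\<close> that by (auto simp: N_def)
    ultimately show ?thesis using k by (meson le_less_trans)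
  qed
  have less: "mrel (\<lambda>n k. \<phi> n < \<phi> k)"
    by (intro mpred_less mfun_comp[OF assms(2)] mintros)
  obtain G where G: "G \<in> M" "infinite G" "G \<subseteq> X"
    "\<And>n k. n \<in> G \<Longrightarrow> k \<in> G \<Longrightarrow> n < k \<Longrightarrow> \<phi> n < \<phi> k"
    by (rule greedy[OF assms(1) less ext]) blast+
  have "inj_on \<phi> G" using G(4) by (metis inj_onI less_irrefl linorder_neqE_nat)
  then have inf: "infinite (\<phi> ` G)" using G(2) finite_image_iff by blast
  \<comment> \<open>To test \<open>y\<close>, move to the first element of \<open>G\<close> whose
    value reaches \<open>y\<close>: by monotonicity \<open>y\<close> is a value on \<open>G\<close>
    exactly if it is attained there.\<close>
  define \<mu> where "\<mu> y = (LEAST z. z \<in> G \<and> y \<le> \<phi> z)" for y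
  have ex: "\<exists>z. z \<in> G \<and> y \<le> \<phi> z" for y
    using inf unfolding infinite_nat_iff_unbounded_le by blast
  have iff: "y \<in> \<phi> ` G \<longleftrightarrow> \<phi> (\<mu> y) = y" for y
  proof
    assume "y \<in> \<phi> ` G"
    then obtain z where z: "z \<in> G" "y = \<phi> z" by blast
    then have "\<mu> y \<le> z" unfolding \<mu>_def by (intro Least_le) simp
    moreover have "\<mu> y \<in> G" "y \<le> \<phi> (\<mu> y)" unfolding \<mu>_def using LeastI_ex[OF ex[of y]] by auto
    ultimately show "\<phi> (\<mu> y) = y" using G(4)[of "\<mu> y" z] z by (cases "\<mu> y = z") auto
  next
    show "\<phi> (\<mu> y) = y \<Longrightarrow> y \<in> \<phi> ` G" unfolding \<mu>_def using LeastI_ex[OF ex[of y]] by (metis imageI)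
  qed
  have "mfun \<mu>" unfolding \<mu>_def
    by (intro mfun_Least ex mpred_conj mpred_le mfun_comp[OF assms(2)] mpred_mem G(1) mintros)
  then have "\<phi> ` G \<in> M" unfolding mem_iff_mpred iff
    by (intro mpred_eq mfun_comp[OF assms(2)] mfun_id)
  with inf show ?thesis using that[of "\<phi> ` G"] G(3) by blast
qed

text \<open>\<open>EM_in\<close> speaks of colorings on all numbers, so \<open>g\<close> is pulled
  back along the increasing enumeration of \<open>T\<close> and the solution is pushed forward
  again. Transitivity survives because the enumeration preserves order.\<close>

lemma EM_on_infinite_subset:
  assumes "EM_in M" "T \<in> M" "infinite T" "mrel g"
  obtains Y where "Y \<in> M" "infinite Y" "Y \<subseteq> T" "transitive_for g Y"
proof -
  let ?e = "enumerate T"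
  have e: "mfun ?e" by (rule mfun_enumerate[OF assms(2,3)])
  have "{prod_encode (x, y) |x y. x < y \<and> g (?e x) (?e y)}
      = {z. pr1 z < pr2 z \<and> g (?e (pr1 z)) (?e (pr2 z))}"
    by (auto, metis prod.collapse prod_decode_inverse)
  moreover have "\<dots> \<in> M"
    by (intro Collect_mem mpred_conj mpred_less mpred_rel[OF assms(4)] mfun_comp[OF e] mfun_pr1
        mfun_pr2 mfun_id)
  ultimately have "coloring_in M (\<lambda>x y. g (?e x) (?e y))" unfolding coloring_in_def by simp
  then obtain H where H: "H \<in> M" "infinite H" "transitive_for (\<lambda>x y. g (?e x) (?e y)) H"
    using assms(1) unfolding EM_in_def by blast
  have mono: "?e x < ?e y \<longleftrightarrow> x < y" for x y using enumerate_mono_iff[OF assms(3)] .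
  have "inj_on ?e H" using mono by (metis inj_onI less_irrefl linorder_neqE_nat)
  then have "infinite (?e ` H)" using H(2) finite_image_iff by blast
  then obtain Y where Y: "Y \<in> M" "infinite Y" "Y \<subseteq> ?e ` H"
    using infinite_image_subset[OF H(1) e] by blast
  have "transitive_for g (?e ` H)"
    using H(3) unfolding transitive_for_def by (simp add: mono)
  then have "transitive_for g Y" using Y(3) unfolding transitive_for_def by (meson subsetD)
  moreover have "Y \<subseteq> T" using Y(3) enumerate_in_set[OF assms(3)] by blast
  ultimately show ?thesis using that Y by blast
qed

end


section \<open>Groupings\<close>

text \<open>Blocks are represented by their codes, so that sets of blocks are sets of numbers and
  can belong to \<open>M\<close>.\<close>

definition blocks_less :: "nat \<Rightarrow> nat \<Rightarrow> bool" where
  "blocks_less c d \<longleftrightarrow> (\<forall>x\<in>set_decode c. \<forall>y\<in>set_decode d. x < y)"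

definition right_hom :: "(nat \<Rightarrow> nat \<Rightarrow> bool) \<Rightarrow> nat \<Rightarrow> nat \<Rightarrow> bool" where
  "right_hom f c d \<longleftrightarrow> (\<forall>x\<in>set_decode c. \<forall>y\<in>set_decode d. \<forall>y'\<in>set_decode d. f x y = f x y')"

definition block_hom :: "(nat \<Rightarrow> nat \<Rightarrow> bool) \<Rightarrow> nat \<Rightarrow> nat \<Rightarrow> bool" where
  "block_hom f c d \<longleftrightarrow> (\<forall>x\<in>set_decode c. \<forall>x'\<in>set_decode c.
     \<forall>y\<in>set_decode d. \<forall>y'\<in>set_decode d. f x y = f x' y')"

text \<open>The order described by \<open>f\<close>: color \<open>True\<close> means agreement with
  the order of the numbers. It is linear on transitive sets.\<close>

definition color_less :: "(nat \<Rightarrow> nat \<Rightarrow> bool) \<Rightarrow> nat \<Rightarrow> nat \<Rightarrow> bool" where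
  "color_less f x y \<longleftrightarrow> x < y \<and> f x y \<or> y < x \<and> \<not> f y x"

section \<open>The linear order on a transitive set\<close>

lemma transitive_forD:
  assumes "transitive_for f H" "x \<in> H" "y \<in> H" "z \<in> H" "x < y" "y < z" "f x y = f y z"
  shows "f x z = f x y"
  using assms unfolding transitive_for_def by (cases "f x z"; cases "f x y") auto

text \<open>For each numerical order of the three points, transitivity of \<open>f\<close> applies
  to the increasing triple: directly when \<open>y\<close> is the middle number, by contradiction
  otherwise.\<close>

lemma color_less_trans:
  assumes f: "transitive_for f H" and H: "x \<in> H" "y \<in> H" "z \<in> H"
    and less: "color_less f x y" "color_less f y z"
  shows "color_less f x z"
proof -
  have "x \<noteq> z" using less by (auto simp: color_less_def)
  then consider "x < y" "y < z" | "x < z" "z < y" | "y < x" "x < z"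
    | "y < z" "z < x" | "z < x" "x < y" | "z < y" "y < x"
    using less by (auto simp: color_less_def) linarith+
  then show ?thesis
  proof cases
    case 1
    then show ?thesis using transitive_forD[OF f, of x y z] H less by (auto simp: color_less_def)
  next
    case 2
    then show ?thesis using transitive_forD[OF f, of x z y] H less by (auto simp: color_less_def)
  next
    case 3
    then show ?thesis using transitive_forD[OF f, of y x z] H less by (auto simp: color_less_def)
  next
    case 4
    then show ?thesis using transitive_forD[OF f, of y z x] H less by (auto simp: color_less_def)
  next
    case 5
    then show ?thesis using transitive_forD[OF f, of z x y] H less by (auto simp: color_less_def)
  next
    case 6
    then show ?thesis using transitive_forD[OF f, of z y x] H less by (auto simp: color_less_def)
  qed
qed

lemma color_less_total: "x \<noteq> y \<Longrightarrow> color_less f x y \<or> color_less f y x"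
  by (auto simp: color_less_def)

lemma color_less_minimum:
  assumes "transitive_for f H" "finite A" "A \<noteq> {}" "A \<subseteq> H"
  shows "\<exists>x\<in>A. \<forall>z\<in>A. z \<noteq> x \<longrightarrow> color_less f x z"
  using assms(2-4)
proof (induction rule: finite_ne_induct)
  case (insert w A)
  then obtain m where m: "m \<in> A" "\<forall>z\<in>A. z \<noteq> m \<longrightarrow> color_less f m z" by auto
  consider "color_less f m w" | "color_less f w m"
    using color_less_total[of m w f] insert.hyps m(1) by blast
  then show ?case
  proof cases
    case 1
    with m show ?thesis by auto
  next
    case 2
    have "color_less f w z" if "z \<in> A" for z
      using color_less_trans[OF assms(1), of w m z] 2 m that insert.prems by (cases "z = m") auto
    then show ?thesis by auto
  qed
qed simp

text \<open>An element of the third block cannot lie strictly inside the order hulls of both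
  other blocks, because these hulls are disjoint.\<close>

lemma block_hom_extend:
  assumes f: "transitive_for f H"
    and H: "set_decode c \<subseteq> H" "set_decode d \<subseteq> H" "set_decode e \<subseteq> H"
    and less: "blocks_less c d" "blocks_less d e"
    and right: "right_hom f c e" "right_hom f d e"
    and hom: "block_hom f c d" and split: "\<not> block_hom f d e"
  shows "block_hom f c e"
proof (rule ccontr)
  assume "\<not> block_hom f c e"
  \<comment> \<open>Right homogeneity lets both failures be observed at a single \<open>y\<close>:
    \<open>x\<close> and \<open>u\<close> lie below it in the order of \<open>f\<close>,
    \<open>x'\<close> and \<open>u'\<close> above.\<close>
  then obtain x x' y where c: "x \<in> set_decode c" "x' \<in> set_decode c" "y \<in> set_decode e"
    "f x y" "\<not> f x' y"
    using right(1) unfolding block_hom_def right_hom_def by metis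
  obtain u u' where d: "u \<in> set_decode d" "u' \<in> set_decode d" "f u y" "\<not> f u' y"
    using split right(2) c(3) unfolding block_hom_def right_hom_def by metis
  have lt: "x < u" "x < u'" "x' < u" "x' < u'" "u < y" "u' < y"
    using less c d unfolding blocks_less_def by auto
  have in_H: "x \<in> H" "x' \<in> H" "y \<in> H" "u \<in> H" "u' \<in> H" using H c d by auto
  \<comment> \<open>Homogeneity places the whole first block on one side of the second: either
    \<open>x'\<close> is below \<open>u\<close>, hence below \<open>y\<close>, or \<open>u'\<close>
    is below \<open>x\<close>, and then \<open>y\<close> is below \<open>x\<close>.\<close>
  have eq: "f x' u = f x u'" using hom c d unfolding block_hom_def by blast
  show False
  proof (cases "f x' u")
    case True
    then have "f x' y = f x' u" using in_H lt d by (intro transitive_forD[OF f]) auto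
    with True c show False by simp
  next
    case False
    then have "f x y = f x u'" using in_H lt d eq by (intro transitive_forD[OF f]) auto
    with False c eq show False by simp
  qed
qed

section \<open>Construction of the blocks\<close>

context omega_model
begin

lemma mrel_blocks_less: "mrel blocks_less"
  unfolding blocks_less_def by (intro mintros)

lemma mrel_right_hom:
  assumes "mrel f" shows "mrel (right_hom f)"
  unfolding right_hom_def by (intro mintros mpred_rel[OF assms])

lemma mrel_block_hom:
  assumes "mrel f" shows "mrel (block_hom f)"
  unfolding block_hom_def by (intro mintros mpred_rel[OF assms])

text \<open>Each point of \<open>Z\<close> divides what lies beyond it into two color classes, both
  in the model; one of them is infinite and is kept.\<close>

lemma infinite_homogeneous_subset:
  assumes "mrel f" "H \<in> M" "infinite H" "finite Z"
  shows "\<exists>X\<in>M. infinite X \<and> X \<subseteq> H \<and> (\<forall>x\<in>Z. \<forall>y\<in>X. x < y \<and> (\<forall>y'\<in>X. f x y = f x y'))"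
  using assms(4)
proof induction
  case empty
  then show ?case using assms by auto
next
  case (insert x Z)
  then obtain X where X: "X \<in> M" "infinite X" "X \<subseteq> H"
    "\<forall>x\<in>Z. \<forall>y\<in>X. x < y \<and> (\<forall>y'\<in>X. f x y = f x y')" by blast
  define A where "A b = {y. y \<in> X \<and> x < y \<and> f x y = b}" for b
  have "X - {..x} = A True \<union> A False" by (auto simp: A_def)
  then obtain b where inf: "infinite (A b)" using X(2) by (metis finite_Diff2 finite_Un finite_atMost)
  have "A b \<in> M" unfolding A_def
    by (intro Collect_mem mpred_conj mpred_iff mpred_mem mpred_less mpred_rel[OF assms(1)] X(1)
        mfun_id mfun_const)
  moreover have "\<forall>z\<in>insert x Z. \<forall>y\<in>A b. z < y \<and> (\<forall>y'\<in>A b. f z y = f z y')"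
    using X(4) by (auto simp: A_def)
  moreover have "A b \<subseteq> H" using X(3) by (auto simp: A_def)
  ultimately show ?case using inf by blast
qed

text \<open>The next block is sought in an infinite set that each point of the chosen blocks sees in
  one color. That set belongs to \<open>M\<close>, so largeness in the model provides a large
  subset.\<close>

lemma right_hom_blocks:
  assumes f: "mrel f" and H: "H \<in> M" "infinite H"
    and L: "family_in M L" "largeness_notion_in M L"
  obtains T where "T \<in> M" "infinite T"
    "\<And>c. c \<in> T \<Longrightarrow> set_decode c \<in> L \<and> set_decode c \<noteq> {} \<and> set_decode c \<subseteq> H"
    "\<And>c d. c \<in> T \<Longrightarrow> d \<in> T \<Longrightarrow> c < d \<Longrightarrow> blocks_less c d \<and> right_hom f c d"
proof -
  \<comment> \<open>\<open>0 < c\<close> excludes the code of the empty set.\<close>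
  define T where "T = {c. c \<in> set_encode ` L \<and> 0 < c \<and> (\<forall>x\<in>set_decode c. x \<in> H)}"
  have T: "T \<in> M" unfolding T_def using L(1) H(1) unfolding family_in_def
    by (intro Collect_mem mintros) auto
  have T_D: "set_decode c \<in> L \<and> set_decode c \<noteq> {} \<and> set_decode c \<subseteq> H" if "c \<in> T" for c
    using that L(1) set_decode_inverse[of c] unfolding T_def family_in_def
    by (auto simp: set_encode_inverse simp del: set_decode_inverse)
  have dec: "mrel (\<lambda>c d. blocks_less c d \<and> right_hom f c d)"
    by (intro mpred_conj mrel_blocks_less mrel_right_hom f)
  have ext: "\<exists>d\<in>T. \<forall>c\<in>S. c < d \<and> blocks_less c d \<and> right_hom f c d"
    if S: "finite S" for S
  proof -
    \<comment> \<open>The codes in \<open>S\<close> are added to the points so that the new block,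
      and hence its code, lies above them.\<close>
    have "finite (S \<union> (\<Union>c\<in>S. set_decode c))" using S by simp
    then obtain X where X: "X \<in> M" "infinite X" "X \<subseteq> H"
      "\<forall>x\<in>S \<union> (\<Union>c\<in>S. set_decode c). \<forall>y\<in>X. x < y \<and> (\<forall>y'\<in>X. f x y = f x y')"
      using infinite_homogeneous_subset[OF f H, of "S \<union> (\<Union>c\<in>S. set_decode c)"] by blast
    \<comment> \<open>\<open>F\<close> may be empty, so a point of \<open>X\<close> is added to it;
      closure under supersets keeps it large.\<close>
    obtain F x where "F \<in> L" "F \<subseteq> X" "x \<in> X"
      using L(2) X(1,2) unfolding largeness_notion_in_def by (metis finite.emptyI all_not_in_conv)
    moreover from this have "finite F" using L(2) unfolding largeness_notion_in_def by blast
    moreover have "F \<subseteq> insert x F" by blast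
    ultimately have F: "insert x F \<in> L" "insert x F \<subseteq> X" "finite (insert x F)"
      using L(2) unfolding largeness_notion_in_def by blast+
    define d where "d = set_encode (insert x F)"
    have D: "set_decode d = insert x F" unfolding d_def by (rule set_encode_inverse[OF F(3)])
    have x: "x \<in> set_decode d" using D by simp
    then have "x < d" by (rule set_decode_less)
    have "d \<in> T" unfolding T_def using F X(3) D \<open>x < d\<close> by (auto simp: d_def)
    moreover have "c < d \<and> blocks_less c d \<and> right_hom f c d" if "c \<in> S" for c
    proof (intro conjI)
      have "c < x" using X(4) that F(2) by blast
      then show "c < d" using \<open>x < d\<close> by simp
      show "blocks_less c d" "right_hom f c d"
        unfolding blocks_less_def right_hom_def D using X(4) F(2) that by blast+
    qed
    ultimately show ?thesis by blast
  qed
  obtain G where "G \<in> M" "infinite G" "G \<subseteq> T"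
    "\<And>c d. c \<in> G \<Longrightarrow> d \<in> G \<Longrightarrow> c < d \<Longrightarrow> blocks_less c d \<and> right_hom f c d"
    by (rule greedy[OF T dec ext]) blast+
  then show ?thesis using that[of G] T_D by blast
qed

section \<open>From sets of codes to groupings\<close>

lemma grouping_of_codes:
  assumes K: "K \<in> M" "infinite K"
    and large: "\<And>c. c \<in> K \<Longrightarrow> set_decode c \<in> L \<and> set_decode c \<noteq> {}"
    and less: "\<And>c d. c \<in> K \<Longrightarrow> d \<in> K \<Longrightarrow> c < d \<Longrightarrow> blocks_less c d"
    and hom: "\<And>c d. c \<in> K \<Longrightarrow> d \<in> K \<Longrightarrow> c < d \<Longrightarrow> block_hom f c d"
  shows "\<exists>F. sequence_in M F \<and> grouping L f F"
proof (intro exI conjI)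
  let ?e = "enumerate K"
  let ?F = "\<lambda>i. set_decode (?e i)"
  have "{prod_encode (i, set_encode (?F i)) |i. True} = {z. pr2 z = ?e (pr1 z)}"
    by (auto, metis prod.collapse prod_decode_inverse)
  moreover have "{z. pr2 z = ?e (pr1 z)} \<in> M"
    by (intro Collect_mem mpred_eq mfun_comp[OF mfun_enumerate[OF K]] mfun_pr1 mfun_pr2 mfun_id)
  ultimately show "sequence_in M ?F" unfolding sequence_in_def by simp
  have e: "?e i \<in> K" "i < j \<Longrightarrow> ?e i < ?e j" for i j
    using enumerate_in_set[OF K(2)] enumerate_mono_iff[OF K(2)] by auto
  have "before (?F i) (?F (Suc i))" for i
  proof -
    have "blocks_less (?e i) (?e (Suc i))" using less e by simp
    then show ?thesis using large[OF e(1), of i] large[OF e(1), of "Suc i"]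
      unfolding before_def blocks_less_def by simp
  qed
  moreover have "\<forall>x\<in>?F i. \<forall>x'\<in>?F i. \<forall>y\<in>?F j. \<forall>y'\<in>?F j. f x y = f x' y'" if "i < j" for i j
    using hom[OF e(1) e(1) e(2)[OF that]] unfolding block_hom_def by blast
  ultimately show "grouping L f ?F" unfolding grouping_def using large[OF e(1)] by blast
qed

text \<open>Ordered blocks inside \<open>Y\<close> have only color \<open>True\<close> between them,
  so it suffices that \<open>right_hom_blocks\<close> supplies large ones.\<close>

lemma grouping_in_homogeneous:
  assumes f: "mrel f" and Y: "Y \<in> M" "infinite Y"
    and L: "family_in M L" "largeness_notion_in M L"
    and hom: "\<And>x y. x \<in> Y \<Longrightarrow> y \<in> Y \<Longrightarrow> x < y \<Longrightarrow> f x y"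
  shows "\<exists>F. sequence_in M F \<and> grouping L f F"
proof -
  obtain T where T: "T \<in> M" "infinite T"
    "\<And>c. c \<in> T \<Longrightarrow> set_decode c \<in> L \<and> set_decode c \<noteq> {} \<and> set_decode c \<subseteq> Y"
    "\<And>c d. c \<in> T \<Longrightarrow> d \<in> T \<Longrightarrow> c < d \<Longrightarrow> blocks_less c d \<and> right_hom f c d"
    using right_hom_blocks[OF f Y L] by blast
  show ?thesis
  proof (rule grouping_of_codes[OF T(1,2)])
    show "block_hom f c d" if "c \<in> T" "d \<in> T" "c < d" for c d
      using T(3)[OF that(1)] T(3)[OF that(2)] T(4)[OF that] hom
      unfolding block_hom_def blocks_less_def by (metis subsetD)
  qed (use T in blast)+
qed

text \<open>Every later block lies inside the hulls of all earlier ones, so the order minima of the blocks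
  form an increasing sequence.\<close>

lemma grouping_of_nested:
  assumes f: "mrel f" "transitive_for f H"
    and L: "family_in M L" "largeness_notion_in M L"
    and S: "S \<in> M" "infinite S"
    and blocks: "\<And>c. c \<in> S \<Longrightarrow> set_decode c \<noteq> {} \<and> set_decode c \<subseteq> H"
    and less: "\<And>c d. c \<in> S \<Longrightarrow> d \<in> S \<Longrightarrow> c < d \<Longrightarrow> blocks_less c d \<and> right_hom f c d"
    and split: "\<And>c d. c \<in> S \<Longrightarrow> d \<in> S \<Longrightarrow> c < d \<Longrightarrow> \<not> block_hom f c d"
  shows "\<exists>F. sequence_in M F \<and> grouping L f F"
proof -
  define is_min where "is_min c x \<longleftrightarrow>
    x \<in> set_decode c \<and> (\<forall>z\<in>set_decode c. (x < z \<longrightarrow> f x z) \<and> (z < x \<longrightarrow> \<not> f z x))" for c x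
  \<comment> \<open>Outside \<open>S\<close> the value is 0, so that the search stops for every
    \<open>c\<close>.\<close>
  define a where "a c = (LEAST x. c \<in> S \<longrightarrow> is_min c x)" for c
  have ex: "\<exists>x. c \<in> S \<longrightarrow> is_min c x" for c
  proof (cases "c \<in> S")
    case True
    then obtain x where "x \<in> set_decode c" "\<forall>z\<in>set_decode c. z \<noteq> x \<longrightarrow> color_less f x z"
      using color_less_minimum[OF f(2) finite_set_decode, of c] blocks[OF True] by blast
    then have "is_min c x" unfolding is_min_def color_less_def by fastforce
    then show ?thesis by blast
  qed simp
  have a: "is_min c (a c)" if "c \<in> S" for c
    using LeastI_ex[OF ex[of c]] that unfolding a_def by blast
  have mfun_a: "mfun a" unfolding a_def
    by (intro mfun_Least ex, unfold is_min_def) (intro mintros S(1) mpred_rel[OF f(1)])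
  have a_mono: "a c < a d \<and> f (a c) (a d)" if cd: "c \<in> S" "d \<in> S" "c < d" for c d
  proof -
    have mem: "a c \<in> set_decode c" "a d \<in> set_decode d" using a cd unfolding is_min_def by auto
    then have lt: "a c < a d" using less[OF cd] unfolding blocks_less_def by blast
    \<comment> \<open>Both colors occur between the two blocks, and each point of \<open>c\<close>
      sees \<open>d\<close> in one color; so some \<open>u\<close> lies below \<open>a d\<close> in
      the order of \<open>f\<close>, and with it the minimum of \<open>c\<close>.\<close>
    obtain u where u: "u \<in> set_decode c" "f u (a d)"
      using split[OF cd] less[OF cd] mem(2) unfolding block_hom_def right_hom_def by metis
    have "u < a d" using less[OF cd] u mem unfolding blocks_less_def by blast
    then have ud: "color_less f u (a d)" using u by (simp add: color_less_def)
    have "f (a c) (a d)"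
    proof (cases "u = a c")
      case False
      then have "color_less f (a c) u"
        using a[OF cd(1)] u(1) unfolding is_min_def color_less_def by (meson linorder_neqE_nat)
      then have "color_less f (a c) (a d)"
        using color_less_trans[OF f(2) _ _ _ _ ud] blocks cd mem u(1) by blast
      then show ?thesis using lt by (simp add: color_less_def)
    qed (use u in simp)
    with lt show ?thesis ..
  qed
  have "inj_on a S" using a_mono by (metis inj_onI less_irrefl linorder_neqE_nat)
  then have "infinite (a ` S)" using S(2) finite_image_iff by blast
  then obtain Y where Y: "Y \<in> M" "infinite Y" "Y \<subseteq> a ` S"
    using infinite_image_subset[OF S(1) mfun_a] by blast
  have "f x y" if xy: "x \<in> Y" "y \<in> Y" "x < y" for x y
  proof -
    obtain c d where "c \<in> S" "d \<in> S" "x = a c" "y = a d" using Y(3) xy by blast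
    with xy show ?thesis using a_mono by (metis less_asym linorder_neqE_nat)
  qed
  then show ?thesis using grouping_in_homogeneous[OF f(1) Y(1,2) L] by blast
qed

section \<open>The two applications of \<open>EM\<close>\<close>

lemma EM_imp_grouping:
  assumes EM: "EM_in M" and f: "mrel f"
    and L: "family_in M L" "largeness_notion_in M L"
  shows "\<exists>F. sequence_in M F \<and> grouping L f F"
proof -
  have "UNIV \<in> M" unfolding mem_iff_mpred by (simp add: mfun_const)
  then obtain H where H: "H \<in> M" "infinite H" "transitive_for f H"
    using EM_on_infinite_subset[OF EM _ _ f, of UNIV] by auto
  obtain T where T: "T \<in> M" "infinite T"
    "\<And>c. c \<in> T \<Longrightarrow> set_decode c \<in> L \<and> set_decode c \<noteq> {} \<and> set_decode c \<subseteq> H"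
    "\<And>c d. c \<in> T \<Longrightarrow> d \<in> T \<Longrightarrow> c < d \<Longrightarrow> blocks_less c d \<and> right_hom f c d"
    using right_hom_blocks[OF f H(1,2) L] by blast
  note hom_dec = mrel_block_hom[OF f]
  obtain S where S: "S \<in> M" "infinite S" "S \<subseteq> T" "transitive_for (\<lambda>c d. \<not> block_hom f c d) S"
    by (rule EM_on_infinite_subset[OF EM T(1,2) mpred_not[OF hom_dec]])
  have blocks: "set_decode c \<in> L \<and> set_decode c \<noteq> {} \<and> set_decode c \<subseteq> H" if "c \<in> S" for c
    using T(3) S(3) that by blast
  have less: "blocks_less c d \<and> right_hom f c d" if "c \<in> S" "d \<in> S" "c < d" for c d
    using T(4) S(3) that by blast
  \<comment> \<open>If \<open>e\<close> does not split \<open>d\<close>, two pairs of the triple are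
    unsplit and transitivity of the second coloring settles the third; otherwise the hull argument
    applies.\<close>
  have extend: "block_hom f c e"
    if "c \<in> S" "d \<in> S" "e \<in> S" "c < d" "d < e" "block_hom f c d" for c d e
  proof (cases "block_hom f d e")
    case True
    then show ?thesis using transitive_forD[OF S(4), of c d e] that by blast
  next
    case False
    moreover have "blocks_less c d" "blocks_less d e" "right_hom f c e" "right_hom f d e"
      using less that by auto
    ultimately show ?thesis using block_hom_extend[OF H(3)] blocks that by blast
  qed
  \<comment> \<open>The first components in \<open>P\<close> are the blocks left unsplit by some
    later block. They form an image that need not lie in \<open>M\<close>, hence the passage to a
    subset \<open>Y\<close>.\<close>
  define P where "P = {z. pr1 z \<in> S \<and> pr2 z \<in> S \<and> pr1 z < pr2 z \<and> block_hom f (pr1 z) (pr2 z)}"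
  have P: "P \<in> M" unfolding P_def by (intro Collect_mem mintros mpred_rel[OF hom_dec] S(1))
  show ?thesis
  proof (cases "finite (pr1 ` P)")
    case False
    then obtain Y where Y: "Y \<in> M" "infinite Y" "Y \<subseteq> pr1 ` P"
      using infinite_image_subset[OF P mfun_pr1[OF mfun_id]] by blast
    \<comment> \<open>Past all witnesses \<open>m n\<close>, \<open>extend\<close> makes every
      \<open>k\<close> in \<open>Y\<close> homogeneous with each \<open>n\<close> in
      \<open>Z\<close>.\<close>
    have ext: "\<exists>k\<in>Y. \<forall>n\<in>Z. n < k \<and> block_hom f n k" if Z: "finite Z" "Z \<subseteq> Y" for Z
    proof -
      have "\<forall>n\<in>Z. \<exists>m. n \<in> S \<and> m \<in> S \<and> n < m \<and> block_hom f n m"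
        using Y(3) Z(2) unfolding P_def by blast
      then obtain m where m: "\<forall>n\<in>Z. n \<in> S \<and> m n \<in> S \<and> n < m n \<and> block_hom f n (m n)" by metis
      obtain k where k: "k \<in> Y" "\<forall>n\<in>Z. m n < k"
      proof -
        have "finite (m ` Z)" using Z(1) by simp
        then obtain N where N: "\<forall>x\<in>m ` Z. x \<le> N" using finite_nat_set_iff_bounded_le by auto
        obtain k where "k \<in> Y" "N < k" using Y(2) infinite_nat_iff_unbounded by blast
        then show ?thesis using that N by fastforce
      qed
      have "k \<in> S" using k(1) Y(3) unfolding P_def by blast
      then have "n < k \<and> block_hom f n k" if "n \<in> Z" for n
        using extend[of n "m n" k] m k(2) that by fastforce
      then show ?thesis using k(1) by blast
    qed
    obtain K where K: "K \<in> M" "infinite K" "K \<subseteq> Y"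
      "\<And>c d. c \<in> K \<Longrightarrow> d \<in> K \<Longrightarrow> c < d \<Longrightarrow> block_hom f c d"
      by (rule greedy[OF Y(1) hom_dec ext]) blast+
    have "K \<subseteq> S" using K(3) Y(3) unfolding P_def by blast
    then have in_S: "c \<in> S" if "c \<in> K" for c using that by blast
    show ?thesis
      by (rule grouping_of_codes[OF K(1,2)]) (use blocks less K(4) in_S in blast)+
  next
    case True
    then obtain N where N: "\<forall>c\<in>pr1 ` P. c \<le> N" using finite_nat_set_iff_bounded_le by auto
    define S' where "S' = {c. c \<in> S \<and> N < c}"
    have S': "S' \<in> M" unfolding S'_def by (intro Collect_mem mintros S(1))
    have inf: "infinite S'"
    proof -
      have "S' = S - {..N}" by (auto simp: S'_def)
      then show ?thesis using S(2) by simp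
    qed
    have split: "\<not> block_hom f c d" if "c \<in> S'" "d \<in> S'" "c < d" for c d
    proof
      assume "block_hom f c d"
      then have "prod_encode (c, d) \<in> P" using that unfolding P_def S'_def by simp
      then have "c \<in> pr1 ` P" by (metis fst_conv image_eqI prod_encode_inverse)
      then show False using N that(1) unfolding S'_def by fastforce
    qed
    have in_S: "c \<in> S" if "c \<in> S'" for c using that unfolding S'_def by blast
    show ?thesis
      by (rule grouping_of_nested[OF f H(3) L S' inf _ _ split]) (use blocks less in_S in blast)+
  qed
qed

end

theorem theorem8p11:
  fixes M :: "nat set set"
  assumes "turing_ideal M"
    and "EM_in M"
  shows "GP22_in M"
  unfolding GP22_in_def
proof (intro allI impI)
  fix L f
  assume L: "family_in M L" "largeness_notion_in M L" and f: "coloring_in M f"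
  interpret omega_model M by unfold_locales (rule assms(1))
  \<comment> \<open>\<open>coloring_in\<close> controls \<open>f\<close> only on pairs
    \<open>x < y\<close>; elsewhere \<open>f'\<close> is \<open>False\<close>, which makes it
    computable in the model on all pairs.\<close>
  define f' where "f' x y \<longleftrightarrow> x < y \<and> f x y" for x y
  have "{prod_encode (x, y) |x y. x < y \<and> f x y} = {z. f' (pr1 z) (pr2 z)}"
    unfolding f'_def by (auto, metis prod.collapse prod_decode_inverse)
  then have "mrel f'" using f by (simp add: coloring_in_def mem_iff_mpred)
  then obtain F where F: "sequence_in M F" "grouping L f' F"
    using EM_imp_grouping[OF assms(2) _ L] by blast
  have fin: "finite (F i)" for i using F(1) unfolding sequence_in_def by blast
  have chain: "F i \<noteq> {} \<and> Max (F i) < Min (F (Suc i))" for i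
    using F(2) unfolding grouping_def before_def by blast
  \<comment> \<open>\<open>grouping\<close> compares successive blocks only; the order of any two is
    needed for \<open>f'\<close> and \<open>f\<close> to agree between blocks.\<close>
  have "Max (F i) < Min (F j)" if "i < j" for i j
    using that
  proof (induction rule: strict_inc_induct)
    case (base i)
    then show ?case using chain by simp
  next
    case (step i)
    have "Min (F (Suc i)) \<le> Max (F (Suc i))"
      using chain[of "Suc i"] fin[of "Suc i"] by (meson Max_in Min_le)
    with chain[of i] step show ?case by linarith
  qed
  then have "x < y" if "i < j" "x \<in> F i" "y \<in> F j" for i j x y
    using that fin by (meson Max_ge Min_le le_less_trans less_le_trans)
  then have "grouping L f F" using F(2) unfolding grouping_def f'_def by meson
  then show "\<exists>F. sequence_in M F \<and> grouping L f F" using F(1) by blast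
qed

end
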